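(* Let $\mathbf F$ be a field. The assignment $[n]\mapsto\mathbf F[\mathcal B_n]$, the Stanley-Reisner ring of the Boolean algebra, where $\pi_i\in H_n(0)$ acts on the basis $\{y_M\}$ of multichains by $$\pi_i(y_M)=\begin{cases}0,&p_i(M)>p_{i+1}(M),\\ y_M,&p_i(M)=p_{i+1}(M),\\ s_i(y_M)+y_M,&p_i(M)<p_{i+1}(M),\end{cases}$$ and where the morphism $\iota_{n,n+1}:[n]\to[n+1]$ acts by sending the basis element of a multichain $A_1\subseteq\dots\subseteq A_k$ in $\mathcal B_n$ to the basis element of the same multichain $A_1\subseteq\dots\subseteq A_k$ regarded in $\mathcal B_{n+1}$, is an $\mathcal H$-module.
   Context: The base field is $\mathbf k=\mathbf F$. For $n\ge 0$ let $[n]=\{1,\dots,n\}$, and let $H_n(0)$ be the unital associative $\mathbf k$-algebra generated by $\pi_1,\dots,\pi_{n-1}$ with relations $\pi_i^2=\pi_i$, $\pi_i\pi_{i+1}\pi_i=\pi_{i+1}\pi_i\pi_{i+1}$, and $\pi_i\pi_j=\pi_j\pi_i$ for $|i-j|>1$. For $w\in\mathfrak S_n$ with reduced expression $w=s_{i_1}\cdots s_{i_r}$ in the adjacent transpositions $s_i=(i,i+1)$, put $\pi_w=\pi_{i_1}\cdots\pi_{i_r}$; the $\pi_w$ form a basis of $H_n(0)$ and a monoid $\mathcal M_n$ under multiplication. For $n\le m$, $\mathcal M_n\subseteq\mathcal M_m$ via $\pi_i\mapsto\pi_i$. The $0$-Hecke category $\mathcal H$ has objects $[n]$, $n\ge0$.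 For $n\le m$, $\mathrm{Hom}_{\mathcal H}([n],[m])$ is the set of braid diagrams from $n$ top vertices to $m$ bottom vertices with only positive crossings, modulo $\pi_i^2=\pi_i$, composed by padding with dummy strands, multiplying in the $0$-Hecke monoid and deleting dummy strands; there are no morphisms if $n>m$. Algebraically, $\mathrm{Hom}_{\mathcal H}([n],[m])$ is the quotient of $\mathcal M_m$ by the equivalence relation generated by $x\sim x\pi_j$ for $n+1\le j\le m-1$, and the composite of the class of $y\in\mathcal M_\ell$ in $\mathrm{Hom}([m],[\ell])$ with the class of $x\in\mathcal M_m$ in $\mathrm{Hom}([n],[m])$ is the class of $yx\in\mathcal M_\ell$. The principal injection $\iota_{n,m}$ is the class of $1$. An $\mathcal H$-module is a functor $V$ from $\mathcal H$ to $\mathbf k$-vector spaces; $V_n=V([n])$ is an $H_n(0)$-module since $\mathrm{End}_{\mathcal H}([n])=\mathcal M_n$. $\mathcal B_n$ is the poset of all subsets of $[n]$ ordered by inclusion. $\mathbf F[\mathcal B_n]=\mathbf F[y_A\mid A\subseteq[n]]/\langle y_Ay_B\mid A,B\text{ incomparable}\rangle$; it has $\mathbf F$-basis the monomials $y_M=y_{A_1}\cdots y_{A_k}$ indexed by multichains $M=(A_1\subseteq\dots\subseteq A_k)$ of subsets of $[n]$ (of any length $k\ge0$). With the conventions $A_0=\emptyset$ and $A_{k+1}=[n]$, put $p_i(M)=\min\{j\in[k+1]\mid i\in A_j\}$ for $i\in[n]$. $s_i(y_M)=y_{s_i(M)}$, where the transposition $s_i=(i,i+1)$ is applied to every set in the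 multichain. *)

theory Defs
  imports
    "HOL-Algebra.Algebra"
    "HOL-Algebra.Algebraic_Closure_Type"
    "HOL-Combinatorics.Permutations"
    "HOL-Library.Poly_Mapping"
begin

section \<open>Free associative algebras\<close>

datatype 'a free_monoid = Word (letters: "'a list")

instantiation free_monoid :: (type) monoid_add
begin

definition "0 = Word []"

definition "u + v = Word (letters u @ letters v)"

instance
  by standard (simp_all add: zero_free_monoid_def plus_free_monoid_def)

end

text \<open>
  Finitely supported functions on a monoid, with the convolution product of
  \<^theory>\<open>HOL-Library.Poly_Mapping\<close>, form the monoid algebra; for the free monoid this is the
  free associative algebra. The generators below are numbered by \<open>1, \<dots>, n - 1\<close>.
\<close>

type_synonym 'k free_alg = "nat free_monoid \<Rightarrow>\<^sub>0 'k"

definition free_algebra :: "nat \<Rightarrow> 'k::field free_alg ring" where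
  "free_algebra n = ring_of_type_algebra
     \<lparr>carrier := {f. \<forall>w \<in> Poly_Mapping.keys f. set (letters w) \<subseteq> {1..<n}}\<rparr>"

definition word :: "nat list \<Rightarrow> 'k::field free_alg" where
  "word is = Poly_Mapping.single (Word is) 1"


section \<open>The algebra \<open>H\<^sub>n(0)\<close> and the monoid \<open>\<M>\<^sub>n\<close>\<close>

definition hecke_relations :: "nat \<Rightarrow> 'k::field free_alg set" where
  "hecke_relations n =
     {word [i, i] - word [i] | i. i \<in> {1..<n}} \<union>
     {word [i, i + 1, i] - word [i + 1, i, i + 1] | i. i \<in> {1..<n} \<and> i + 1 \<in> {1..<n}} \<union>
     {word [i, j] - word [j, i] | i j. i \<in> {1..<n} \<and> j \<in> {1..<n} \<and> \<bar>int i - int j\<bar> > 1}"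

definition hecke_ideal :: "nat \<Rightarrow> 'k::field free_alg set" where
  "hecke_ideal n = Idl\<^bsub>free_algebra n\<^esub> (hecke_relations n)"

definition hecke_algebra :: "nat \<Rightarrow> 'k::field free_alg set ring" where
  "hecke_algebra n = free_algebra n Quot hecke_ideal n"

text \<open>The element \<open>\<pi>\<^bsub>i\<^sub>1\<^esub> \<cdots> \<pi>\<^bsub>i\<^sub>r\<^esub>\<close> of \<open>H\<^sub>n(0)\<close>.\<close>

definition hecke_word :: "nat \<Rightarrow> nat list \<Rightarrow> 'k::field free_alg set" where
  "hecke_word n is = hecke_ideal n +>\<^bsub>free_algebra n\<^esub> word is"

definition perm_of_word :: "nat list \<Rightarrow> nat \<Rightarrow> nat" where
  "perm_of_word is = foldr (\<lambda>i w. transpose i (i + 1) \<circ> w) is id"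

definition reduced_expression :: "nat \<Rightarrow> (nat \<Rightarrow> nat) \<Rightarrow> nat list \<Rightarrow> bool" where
  "reduced_expression n w is \<longleftrightarrow>
     set is \<subseteq> {1..<n} \<and> perm_of_word is = w \<and>
     (\<forall>js. set js \<subseteq> {1..<n} \<and> perm_of_word js = w \<longrightarrow> length is \<le> length js)"

definition hecke_monoid :: "nat \<Rightarrow> 'k::field free_alg set set" where
  "hecke_monoid n = {hecke_word n is | w is. w permutes {1..n} \<and> reduced_expression n w is}"

text \<open>
  For \<open>n \<le> m\<close>, the algebra map \<open>H\<^sub>n(0) \<rightarrow> H\<^sub>m(0)\<close> with \<open>\<pi>\<^sub>i \<mapsto> \<pi>\<^sub>i\<close>; the ideal for \<open>n\<close>
  is contained in the one for \<open>m\<close>, so all cosets in the union coincide.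
\<close>

definition hecke_incl :: "nat \<Rightarrow> 'k::field free_alg set \<Rightarrow> 'k free_alg set" where
  "hecke_incl m x = (\<Union>a\<in>x. hecke_ideal m +>\<^bsub>free_algebra m\<^esub> a)"


section \<open>The 0-Hecke category\<close>

definition hecke_equiv ::
    "nat \<Rightarrow> nat \<Rightarrow> 'k::field free_alg set \<Rightarrow> 'k free_alg set \<Rightarrow> bool" where
  "hecke_equiv n m = equivclp (\<lambda>x z. x \<in> hecke_monoid m \<and>
     (\<exists>j\<in>{n + 1..<m}. z = x \<otimes>\<^bsub>hecke_algebra m\<^esub> hecke_word m [j]))"

definition hecke_class ::
    "nat \<Rightarrow> nat \<Rightarrow> 'k::field free_alg set \<Rightarrow> 'k free_alg set set" where
  "hecke_class n m x = {z. hecke_equiv n m x z}"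

definition hecke_hom :: "nat \<Rightarrow> nat \<Rightarrow> 'k::field free_alg set set set" where
  "hecke_hom n m = (if n \<le> m then hecke_class n m ` hecke_monoid m else {})"

text \<open>
  The composite of \<open>g : [m] \<rightarrow> [l]\<close> with \<open>f : [n] \<rightarrow> [m]\<close>. The class of \<open>y x\<close> does not depend on
  the chosen representatives: \<open>\<pi>\<^sub>j\<close> with \<open>j > m\<close> commutes with \<open>\<M>\<^sub>m\<close>.
\<close>

definition hecke_comp ::
    "nat \<Rightarrow> nat \<Rightarrow> nat \<Rightarrow> 'k::field free_alg set set \<Rightarrow> 'k free_alg set set \<Rightarrow> 'k free_alg set set"
  where
  "hecke_comp n m l g f =
     (\<Union>y\<in>g. \<Union>x\<in>f. hecke_class n l (y \<otimes>\<^bsub>hecke_algebra l\<^esub> hecke_incl l x))"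

text \<open>The principal injection; for \<open>m = n\<close> it is the identity of \<open>[n]\<close>.\<close>

definition hecke_iota :: "nat \<Rightarrow> nat \<Rightarrow> 'k::field free_alg set set" where
  "hecke_iota n m = hecke_class n m \<one>\<^bsub>hecke_algebra m\<^esub>"

text \<open>The generator \<open>\<pi>\<^sub>i\<close> as an endomorphism of \<open>[n]\<close>.\<close>

definition hecke_pi :: "nat \<Rightarrow> nat \<Rightarrow> 'k::field free_alg set set" where
  "hecke_pi n i = hecke_class n n (hecke_word n [i])"

definition linear_map :: "('k::field, 'v) module \<Rightarrow> ('k, 'w) module \<Rightarrow> ('v \<Rightarrow> 'w) \<Rightarrow> bool" where
  "linear_map V W f \<longleftrightarrow>
     f \<in> carrier V \<rightarrow> carrier W \<and>
     (\<forall>u\<in>carrier V. \<forall>v\<in>carrier V. f (u \<oplus>\<^bsub>V\<^esub> v) = f u \<oplus>\<^bsub>W\<^esub> f v) \<and>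
     (\<forall>c. \<forall>v\<in>carrier V. f (c \<odot>\<^bsub>V\<^esub> v) = c \<odot>\<^bsub>W\<^esub> f v)"

text \<open>A functor from the 0-Hecke category to vector spaces; equations are only required on carriers.\<close>

locale hecke_module =
  fixes V :: "nat \<Rightarrow> ('k::field, 'v) module"
    and act :: "nat \<Rightarrow> nat \<Rightarrow> 'k free_alg set set \<Rightarrow> 'v \<Rightarrow> 'v"
  assumes vector_space: "Module.module ring_of_type_algebra (V n)"
    and linear: "f \<in> hecke_hom n m \<Longrightarrow> linear_map (V n) (V m) (act n m f)"
    and identity: "v \<in> carrier (V n) \<Longrightarrow> act n n (hecke_iota n n) v = v"
    and composition:
      "\<lbrakk>f \<in> hecke_hom n m; g \<in> hecke_hom m l; v \<in> carrier (V n)\<rbrakk>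
        \<Longrightarrow> act n l (hecke_comp n m l g f) v = act m l g (act n m f v)"


section \<open>The Stanley-Reisner ring of the Boolean algebra\<close>

text \<open>Monomials in the variables \<open>y\<^sub>A\<close> are exponent functions on sets.\<close>

type_synonym 'k sr_poly = "(nat set \<Rightarrow>\<^sub>0 nat) \<Rightarrow>\<^sub>0 'k"

definition sr_poly_ring :: "nat \<Rightarrow> 'k::field sr_poly ring" where
  "sr_poly_ring n = ring_of_type_algebra
     \<lparr>carrier := {p. \<forall>e \<in> Poly_Mapping.keys p. Poly_Mapping.keys e \<subseteq> Pow {1..n}}\<rparr>"

definition sr_var :: "nat set \<Rightarrow> 'k::field sr_poly" where
  "sr_var A = Poly_Mapping.single (Poly_Mapping.single A 1) 1"

definition sr_ideal :: "nat \<Rightarrow> 'k::field sr_poly set" where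
  "sr_ideal n = Idl\<^bsub>sr_poly_ring n\<^esub>
     {sr_var A * sr_var B | A B. A \<subseteq> {1..n} \<and> B \<subseteq> {1..n} \<and> \<not> A \<subseteq> B \<and> \<not> B \<subseteq> A}"

definition sr_class :: "nat \<Rightarrow> 'k::field sr_poly \<Rightarrow> 'k sr_poly set" where
  "sr_class n p = sr_ideal n +>\<^bsub>sr_poly_ring n\<^esub> p"

text \<open>The scalars act through the constant polynomials.\<close>

definition stanley_reisner :: "nat \<Rightarrow> ('k::field, 'k sr_poly set) module" where
  "stanley_reisner n =
     (let Q = sr_poly_ring n Quot sr_ideal n
      in ring.extend Q
           (module.fields (\<lambda>c v. sr_class n (Poly_Mapping.single 0 c) \<otimes>\<^bsub>Q\<^esub> v)))"

text \<open>Multichains \<open>A\<^sub>1 \<subseteq> \<dots> \<subseteq> A\<^sub>k\<close> of subsets of \<open>[n]\<close> are lists of length \<open>k\<close>.\<close>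

definition multichain :: "nat \<Rightarrow> nat set list \<Rightarrow> bool" where
  "multichain n M \<longleftrightarrow> sorted_wrt (\<subseteq>) M \<and> (\<forall>A \<in> set M. A \<subseteq> {1..n})"

definition sr_monomial :: "nat \<Rightarrow> nat set list \<Rightarrow> 'k::field sr_poly set" where
  "sr_monomial n M = sr_class n (prod_list (map sr_var M))"

definition chain_entry :: "nat \<Rightarrow> nat set list \<Rightarrow> nat \<Rightarrow> nat set" where
  "chain_entry n M j =
     (if j = 0 then {} else if j \<le> length M then M ! (j - 1) else {1..n})"

definition chain_pos :: "nat \<Rightarrow> nat set list \<Rightarrow> nat \<Rightarrow> nat" where
  "chain_pos n M i = Min {j \<in> {1..length M + 1}. i \<in> chain_entry n M j}"

definition chain_swap :: "nat \<Rightarrow> nat set list \<Rightarrow> nat set list" where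
  "chain_swap i M = map ((`) (transpose i (i + 1))) M"

end

theory Submission
  imports Defs
begin

text \<open>
  Each \<open>\<pi>\<^sub>i\<close> is lifted to a linear operator on the polynomial ring in all the \<open>y\<^sub>A\<close>, fixing the
  monomials that are not supported on a chain. On a monomial \<open>y\<^sub>M\<close> it only depends on the comparison
  of \<open>p\<^sub>i(M)\<close> with \<open>p\<^bsub>i+1\<^esub>(M)\<close>, and \<open>p(M)\<close> induces a weak order on the indices; checking the weak
  orders on three indices gives the braid relation. So the free algebra acts with the Hecke ideal in
  the kernel, and this action preserves the Stanley-Reisner ideals. Finally \<open>\<pi>\<^sub>j\<close> with \<open>j > n\<close> fixes
  every polynomial in the \<open>y\<^sub>A\<close> with \<open>A \<subseteq> [n]\<close>, because no such \<open>A\<close> contains \<open>j\<close> or \<open>j + 1\<close>. Hence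
  the class of \<open>x \<in> \<M>\<^sub>m\<close> in \<open>Hom([n], [m])\<close> acts unambiguously, by the inclusion of polynomial rings
  followed by \<open>x\<close>.
\<close>

section \<open>Operators on polynomials\<close>

definition scalar :: "'k::field \<Rightarrow> 'k sr_poly" where
  "scalar c = Poly_Mapping.single 0 c"

lemma scalar_0 [simp]: "scalar 0 = 0"
  and scalar_1 [simp]: "scalar 1 = 1"
  and scalar_add: "scalar (c + d) = scalar c + scalar d"
  and scalar_mult: "scalar (c * d) = scalar c * scalar d"
  by (simp_all add: scalar_def single_add mult_single)

text \<open>The index type is left open so that the same linear extension serves polynomials, whose
  basis consists of exponents, and the free algebra, whose basis consists of words.\<close>

definition lin :: "('a \<Rightarrow> 'k::field sr_poly) \<Rightarrow> ('a \<Rightarrow>\<^sub>0 'k) \<Rightarrow> 'k sr_poly" where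
  "lin f p = (\<Sum>e\<in>Poly_Mapping.keys p. scalar (Poly_Mapping.lookup p e) * f e)"

lemma lin_superset:
  assumes "finite S" "Poly_Mapping.keys p \<subseteq> S"
  shows "lin f p = (\<Sum>e\<in>S. scalar (Poly_Mapping.lookup p e) * f e)"
  unfolding lin_def using assms
  by (intro sum.mono_neutral_left) (auto simp: in_keys_iff)

lemma lin_0 [simp]: "lin f 0 = 0"
  by (simp add: lin_def)

lemma lin_add: "lin f (p + q) = lin f p + lin f q"
proof -
  let ?S = "Poly_Mapping.keys p \<union> Poly_Mapping.keys q"
  have "lin f r = (\<Sum>e\<in>?S. scalar (Poly_Mapping.lookup r e) * f e)"
    if "Poly_Mapping.keys r \<subseteq> ?S" for r
    using that by (intro lin_superset) auto
  from this[of p] this[of q] this[of "p + q"] show ?thesis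
    using Poly_Mapping.keys_add[of p q]
    by (simp add: lookup_add scalar_add distrib_right sum.distrib)
qed

lemma lin_uminus: "lin f (- p) = - lin f p"
  using lin_add[of f p "- p"] by (simp add: eq_neg_iff_add_eq_0 add.commute)

lemma lin_diff: "lin f (p - q) = lin f p - lin f q"
  using lin_add[of f p "- q"] by (simp add: lin_uminus)

lemma lin_single: "lin f (Poly_Mapping.single e c) = scalar c * f e"
  by (cases "c = 0") (simp_all add: lin_def)

text \<open>A finitely supported function is a finite sum of singles, built up one new key at a
  time. Coefficients are arbitrary here, so additivity alone reduces the comparison to
  singles.\<close>

lemma poly_mapping_additive_eqI:
  fixes F G :: "('a \<Rightarrow>\<^sub>0 'b::comm_monoid_add) \<Rightarrow> 'c::ab_group_add"
  assumes "\<And>p q. F (p + q) = F p + F q" "\<And>p q. G (p + q) = G p + G q"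
    and "\<And>e c. F (Poly_Mapping.single e c) = G (Poly_Mapping.single e c)"
  shows "F p = G p"
proof (induction p rule: update_induct)
  case const
  show ?case
    \<comment> \<open>Additivity gives \<open>F 0 = F 0 + F 0\<close>, which forces
      \<open>F 0 = 0\<close> because the codomain is a group; likewise for \<open>G\<close>.\<close>
    using assms(1)[of 0 0] assms(2)[of 0 0] by simp
next
  case (update p e c)
  have "Poly_Mapping.update e c p = Poly_Mapping.single e c + p"
    using update(1) by (intro poly_mapping_eqI)
      (auto simp: lookup_update lookup_add lookup_single when_def in_keys_iff)
  then show ?case
    using assms update by simp
qed

lemma lin_scale: "lin f (scalar c * p) = scalar c * lin f p"
  by (rule poly_mapping_additive_eqI[where p = p])
    (simp_all add: lin_add distrib_left lin_single, simp add: scalar_def mult_single lin_single ac_simps)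

lemma lin_monomial [simp]: "lin (\<lambda>e. Poly_Mapping.single e 1) p = p"
  by (rule poly_mapping_additive_eqI[where p = p])
    (simp_all add: lin_add lin_single scalar_def mult_single)

lemma lin_cong:
  "(\<And>e. e \<in> Poly_Mapping.keys p \<Longrightarrow> f e = g e) \<Longrightarrow> lin f p = lin g p"
  by (simp add: lin_def)

lemma lin_fun_add: "lin (\<lambda>e. f e + g e) p = lin f p + lin g p"
  by (simp add: lin_def distrib_left sum.distrib)

lemma lin_fun_scale: "lin (\<lambda>e. scalar c * f e) p = scalar c * lin f p"
  by (simp add: lin_def sum_distrib_left ac_simps)

section \<open>Chains, separation and swaps on exponents\<close>

definition chain_exponent :: "(nat set \<Rightarrow>\<^sub>0 nat) \<Rightarrow> bool" where
  "chain_exponent e \<longleftrightarrow>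
     (\<forall>A\<in>Poly_Mapping.keys e. \<forall>B\<in>Poly_Mapping.keys e. A \<subseteq> B \<or> B \<subseteq> A)"

text \<open>
  For the exponent of a multichain \<open>M\<close> this says \<open>p\<^sub>i(M) < p\<^sub>j(M)\<close>.
\<close>

definition separates :: "(nat set \<Rightarrow>\<^sub>0 nat) \<Rightarrow> nat \<Rightarrow> nat \<Rightarrow> bool" where
  "separates e i j \<longleftrightarrow> (\<exists>A\<in>Poly_Mapping.keys e. i \<in> A \<and> j \<notin> A)"

text \<open>\<open>Poly_Mapping.map_key\<close> pulls an exponent back along a map of sets. The
  transposition is an involution, so this pullback is also the pushforward, that is, the action of
  \<open>s_i\<close> on monomials.\<close>

definition swap_exponent :: "nat \<Rightarrow> (nat set \<Rightarrow>\<^sub>0 nat) \<Rightarrow> (nat set \<Rightarrow>\<^sub>0 nat)" where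
  "swap_exponent i e = Poly_Mapping.map_key ((`) (transpose i (i + 1))) e"

lemma inj_image_transpose: "inj ((`) (transpose i j))"
  by (intro injI) (simp add: inj_image_eq_iff)

lemma lookup_swap_exponent:
  "Poly_Mapping.lookup (swap_exponent i e) A = Poly_Mapping.lookup e (transpose i (i + 1) ` A)"
  unfolding swap_exponent_def
  by (simp add: map_key.rep_eq[OF inj_image_transpose])

lemma in_keys_swap_exponent:
  "A \<in> Poly_Mapping.keys (swap_exponent i e) \<longleftrightarrow> transpose i (i + 1) ` A \<in> Poly_Mapping.keys e"
  by (simp add: in_keys_iff lookup_swap_exponent)

lemma keys_swap_exponent:
  "Poly_Mapping.keys (swap_exponent i e) = (`) (transpose i (i + 1)) ` Poly_Mapping.keys e"
proof (rule Set.set_eqI)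
  fix A
  have "transpose i (i + 1) ` transpose i (i + 1) ` B = B" for B
    by (simp add: image_comp)
  then show "A \<in> Poly_Mapping.keys (swap_exponent i e) \<longleftrightarrow>
      A \<in> (`) (transpose i (i + 1)) ` Poly_Mapping.keys e"
    unfolding in_keys_swap_exponent image_iff by (intro iffI bexI[rotated]) auto
qed

lemma chain_exponent_swap [simp]: "chain_exponent (swap_exponent i e) \<longleftrightarrow> chain_exponent e"
  unfolding chain_exponent_def keys_swap_exponent
  by (simp add: inj_image_subset_iff)

lemma separates_swap [simp]:
  "separates (swap_exponent i e) j k \<longleftrightarrow>
     separates e (transpose i (i + 1) j) (transpose i (i + 1) k)"
proof -
  have "x \<in> transpose i (i + 1) ` A \<longleftrightarrow> transpose i (i + 1) x \<in> A" for x A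
    by (metis (no_types, lifting) image_iff transpose_involutory)
  then show ?thesis
    unfolding separates_def keys_swap_exponent by simp
qed

lemma swap_exponent_commute:
  assumes "i + 1 < j"
  shows "swap_exponent i (swap_exponent j e) = swap_exponent j (swap_exponent i e)"
proof -
  have "transpose i (i + 1) \<circ> transpose j (j + 1) = transpose j (j + 1) \<circ> transpose i (i + 1)"
    using assms by (auto simp: fun_eq_iff transpose_def)
  then show ?thesis
    by (intro poly_mapping_eqI) (simp add: lookup_swap_exponent image_comp del: Suc_eq_plus1)
qed

lemma swap_exponent_braid:
  "swap_exponent i (swap_exponent (i + 1) (swap_exponent i e)) =
   swap_exponent (i + 1) (swap_exponent i (swap_exponent (i + 1) e))"
proof -
  have "transpose i (i + 1) (transpose (i + 1) (i + 2) (transpose i (i + 1) x)) =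
      transpose (i + 1) (i + 2) (transpose i (i + 1) (transpose (i + 1) (i + 2) x))" for x
    by (auto simp: transpose_def)
  then show ?thesis
    by (intro poly_mapping_eqI) (simp add: lookup_swap_exponent image_image)
qed

text \<open>A set containing \<open>i\<close> but not \<open>j\<close> and a set containing
  \<open>j\<close> but not \<open>i\<close> are incomparable.\<close>

lemma separates_asym: "chain_exponent e \<Longrightarrow> separates e i j \<Longrightarrow> \<not> separates e j i"
  unfolding chain_exponent_def separates_def by blast

text \<open>The separating set either contains \<open>j\<close> or omits it. Together with asymmetry
  this makes \<open>separates e\<close> a strict weak order on the indices whenever \<open>e\<close>
  is supported on a chain.\<close>

lemma separates_cotrans: "separates e i k \<Longrightarrow> separates e i j \<or> separates e j k"
  unfolding separates_def by blast

section \<open>The operators of the generators and the 0-Hecke relations\<close>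

text \<open>
  A monomial that is not supported on a chain lies in the Stanley-Reisner ideal, and \<open>\<pi>\<^sub>i\<close> is made to
  fix it: then the 0-Hecke relations hold on all polynomials, and the ideal is preserved.
\<close>

definition pi_monomial :: "nat \<Rightarrow> (nat set \<Rightarrow>\<^sub>0 nat) \<Rightarrow> 'k::field sr_poly" where
  "pi_monomial i e =
     (if chain_exponent e \<and> separates e (i + 1) i then 0
      else if chain_exponent e \<and> separates e i (i + 1)
      then Poly_Mapping.single (swap_exponent i e) 1 + Poly_Mapping.single e 1
      else Poly_Mapping.single e 1)"

definition pi_op :: "nat \<Rightarrow> 'k::field sr_poly \<Rightarrow> 'k sr_poly" where
  "pi_op i = lin (pi_monomial i)"

lemma pi_op_0 [simp]: "pi_op i 0 = 0"
  by (simp add: pi_op_def)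

lemma pi_op_add: "pi_op i (p + q) = pi_op i p + pi_op i q"
  by (simp add: pi_op_def lin_add)

lemma pi_op_scale: "pi_op i (scalar c * p) = scalar c * pi_op i p"
  by (simp add: pi_op_def lin_scale)

lemma pi_op_monomial: "pi_op i (Poly_Mapping.single e 1) = pi_monomial i e"
  by (simp add: pi_op_def lin_single)

lemma linear_op_eqI:
  fixes F G :: "'k::field sr_poly \<Rightarrow> 'k sr_poly"
  assumes "\<And>p q. F (p + q) = F p + F q" "\<And>p q. G (p + q) = G p + G q"
    and "\<And>c p. F (scalar c * p) = scalar c * F p" "\<And>c p. G (scalar c * p) = scalar c * G p"
    and "\<And>e. F (Poly_Mapping.single e 1) = G (Poly_Mapping.single e 1)"
  shows "F p = G p"
proof (rule poly_mapping_additive_eqI[where p = p])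
  fix e :: "nat set \<Rightarrow>\<^sub>0 nat" and c :: 'k
  have "Poly_Mapping.single e c = scalar c * Poly_Mapping.single e 1"
    by (simp add: scalar_def mult_single)
  then show "F (Poly_Mapping.single e c) = G (Poly_Mapping.single e c)"
    using assms by simp
qed (use assms in simp_all)

text \<open>In the only case producing a sum, the swapped monomial separates \<open>i + 1\<close>
  from \<open>i\<close> and is killed by the second application, while the original monomial
  reproduces the same sum.\<close>

lemma pi_op_idem: "pi_op i (pi_op i p) = pi_op i p"
proof (rule linear_op_eqI[where p = p])
  fix e :: "nat set \<Rightarrow>\<^sub>0 nat"
  show "pi_op i (pi_op i (Poly_Mapping.single e 1)) = pi_op i (Poly_Mapping.single e 1)"
    using separates_asym[of e i "i + 1"]
    by (auto simp: pi_op_monomial pi_monomial_def pi_op_add)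
qed (simp_all add: pi_op_add pi_op_scale)

text \<open>Each of the two transpositions fixes both indices compared by the other operator. Hence
  neither operator changes the case in which the other one falls, and the swaps themselves
  commute.\<close>

lemma pi_op_commute:
  assumes "i + 1 < j"
  shows "pi_op i (pi_op j p) = pi_op j (pi_op i p)"
proof (rule linear_op_eqI[where p = p])
  fix e :: "nat set \<Rightarrow>\<^sub>0 nat"
  have *: "transpose i (i + 1) j = j" "transpose i (i + 1) (j + 1) = j + 1"
    "transpose j (j + 1) i = i" "transpose j (j + 1) (i + 1) = i + 1"
    using assms by (auto simp: transpose_def)
  show "pi_op i (pi_op j (Poly_Mapping.single e 1)) = pi_op j (pi_op i (Poly_Mapping.single e 1))"
    using * by (auto simp: pi_op_monomial pi_monomial_def pi_op_add swap_exponent_commute[OF assms])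
qed (simp_all add: pi_op_add pi_op_scale)

lemma pi_op_braid:
  "pi_op i (pi_op (i + 1) (pi_op i p)) = pi_op (i + 1) (pi_op i (pi_op (i + 1) p))"
proof (rule linear_op_eqI[where p = p])
  fix e :: "nat set \<Rightarrow>\<^sub>0 nat"
  show "pi_op i (pi_op (i + 1) (pi_op i (Poly_Mapping.single e 1))) =
    pi_op (i + 1) (pi_op i (pi_op (i + 1) (Poly_Mapping.single e 1)))"
  proof (cases "chain_exponent e")
    case False
    then show ?thesis by (simp add: pi_op_monomial pi_monomial_def)
  next
    case chain: True
    \<comment> \<open>Opaque names keep the three indices atomic for the simplifier; the needed
      values of the transpositions are supplied as rewrite rules.\<close>
    define a b c where "a = i" and "b = i + 1" and "c = i + 2"
    have [simp]: "transpose a b a = b" "transpose a b b = a" "transpose a b c = c"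
      "transpose b c a = a" "transpose b c b = c" "transpose b c c = b"
      by (auto simp: a_def b_def c_def transpose_def)
    have mon: "pi_op a (Poly_Mapping.single e 1) = (if separates e b a then 0
        else if separates e a b then Poly_Mapping.single (swap_exponent a e) 1 + Poly_Mapping.single e 1
        else Poly_Mapping.single e 1)"
      "pi_op b (Poly_Mapping.single e 1) = (if separates e c b then 0
        else if separates e b c then Poly_Mapping.single (swap_exponent b e) 1 + Poly_Mapping.single e 1
        else Poly_Mapping.single e 1)" if "chain_exponent e" for e
      using that by (simp_all add: pi_op_monomial pi_monomial_def a_def b_def c_def)
    have sep: "separates (swap_exponent a e) x y = separates e (transpose a b x) (transpose a b y)"
      "separates (swap_exponent b e) x y = separates e (transpose b c x) (transpose b c y)" for x y e
      unfolding a_def b_def c_def by simp_all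
    \<comment> \<open>When \<open>a\<close>, \<open>b\<close>, \<open>c\<close> have strictly
      increasing positions, both sides are the sum over all six permutations of the three indices.
      The longest permutation arises from two different words, which this equation brings to one
      form.\<close>
    have braid: "swap_exponent b (swap_exponent a (swap_exponent b e)) =
        swap_exponent a (swap_exponent b (swap_exponent a e))"
      unfolding a_def b_def by (rule swap_exponent_braid[symmetric])
    have asym: "\<not> (separates e x y \<and> separates e y x)" for x y
      using separates_asym[OF chain] by blast
    note co = separates_cotrans[of e]
    have "pi_op a (pi_op b (pi_op a (Poly_Mapping.single e 1))) =
      pi_op b (pi_op a (pi_op b (Poly_Mapping.single e 1)))"
      using asym[of a b] asym[of b c] asym[of a c]
        co[of a b c] co[of a c b] co[of b a c] co[of b c a] co[of c a b] co[of c b a]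
      \<comment> \<open>The values of both sides depend only on these six truth values. Assignments
        violating asymmetry or cotransitivity are contradictory; the others are the weak orders on
        three indices, and there both sides are computed.\<close>
      by (cases "separates e a b"; cases "separates e b a"; cases "separates e b c";
          cases "separates e c b"; cases "separates e a c"; cases "separates e c a")
        (simp_all add: mon sep chain braid pi_op_add del: separates_swap)
    then show ?thesis
      by (simp add: a_def b_def)
  qed
qed (simp_all add: pi_op_add pi_op_scale)

section \<open>Action of the free algebra\<close>

lemma ring_of_type_algebra_simps [simp]:
  "carrier ring_of_type_algebra = UNIV"
  "x \<oplus>\<^bsub>ring_of_type_algebra\<^esub> y = x + y"
  "x \<otimes>\<^bsub>ring_of_type_algebra\<^esub> y = x * y"
  "\<zero>\<^bsub>ring_of_type_algebra\<^esub> = 0"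
  "\<one>\<^bsub>ring_of_type_algebra\<^esub> = 1"
  by (simp_all add: ring_of_type_algebra_def)

text \<open>The ring laws are inherited from the type class, so only closure is at stake; zero is
  obtained as \<open>1 + (- 1)\<close>.\<close>

lemma subalgebra_ring:
  fixes C :: "'a::ring_1 set"
  assumes "1 \<in> C" "\<And>x y. x \<in> C \<Longrightarrow> y \<in> C \<Longrightarrow> x + y \<in> C"
    "\<And>x y. x \<in> C \<Longrightarrow> y \<in> C \<Longrightarrow> x * y \<in> C" "\<And>x. x \<in> C \<Longrightarrow> - x \<in> C"
  shows "ring (ring_of_type_algebra\<lparr>carrier := C\<rparr>)"
proof (rule ringI)
  have "1 + (- 1) \<in> C" using assms by blast
  then have "0 \<in> C" by simp
  moreover have "\<exists>y\<in>C. y + x = 0" if "x \<in> C" for x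
    using assms(4)[OF that] by (intro bexI[of _ "- x"]) auto
  ultimately show "abelian_group (ring_of_type_algebra\<lparr>carrier := C\<rparr>)"
    by (intro abelian_groupI) (simp_all add: assms ac_simps)
  show "Group.monoid (ring_of_type_algebra\<lparr>carrier := C\<rparr>)"
    by (intro monoidI) (simp_all add: assms mult.assoc)
qed (simp_all add: distrib_left distrib_right)

lemma subalgebra_minus:
  fixes C :: "'a::ring_1 set"
  assumes "ring (ring_of_type_algebra\<lparr>carrier := C\<rparr>)" and "x \<in> C"
  shows "\<ominus>\<^bsub>ring_of_type_algebra\<lparr>carrier := C\<rparr>\<^esub> x = - x"
    and "- x \<in> C"
proof -
  interpret ring "ring_of_type_algebra\<lparr>carrier := C\<rparr>" by fact
  have "x + (\<ominus>\<^bsub>ring_of_type_algebra\<lparr>carrier := C\<rparr>\<^esub> x) = 0"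
    using r_neg[of x] assms(2) by simp
  then show *: "\<ominus>\<^bsub>ring_of_type_algebra\<lparr>carrier := C\<rparr>\<^esub> x = - x"
    by (simp add: eq_neg_iff_add_eq_0 add.commute)
  show "- x \<in> C"
    using a_inv_closed[of x] assms(2) by (simp add: *)
qed

text \<open>Closure of \<open>I\<close> under negation comes from multiplication by
  \<open>- 1\<close>, which belongs to \<open>C\<close>.\<close>

lemma subalgebra_idealI:
  fixes C :: "'a::ring_1 set"
  assumes R: "ring (ring_of_type_algebra\<lparr>carrier := C\<rparr>)"
    and "I \<subseteq> C" "0 \<in> I" "\<And>x y. x \<in> I \<Longrightarrow> y \<in> I \<Longrightarrow> x + y \<in> I"
    "\<And>a x. a \<in> C \<Longrightarrow> x \<in> I \<Longrightarrow> a * x \<in> I" "\<And>a x. a \<in> C \<Longrightarrow> x \<in> I \<Longrightarrow> x * a \<in> I"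
  shows "ideal I (ring_of_type_algebra\<lparr>carrier := C\<rparr>)"
proof -
  interpret ring "ring_of_type_algebra\<lparr>carrier := C\<rparr>" by fact
  have "- x \<in> I" if "x \<in> I" for x
    using assms(5)[of "- 1" x] subalgebra_minus(2)[OF R, of 1] one_closed that by simp
  then have "\<ominus>\<^bsub>ring_of_type_algebra\<lparr>carrier := C\<rparr>\<^esub> x \<in> I" if "x \<in> I" for x
    using that assms(2) subalgebra_minus(1)[OF R] by auto
  then have "subgroup I (add_monoid (ring_of_type_algebra\<lparr>carrier := C\<rparr>))"
    using assms by (intro add.subgroupI) (auto simp: a_inv_def)
  then show ?thesis
    using assms by (intro idealI) auto
qed

section \<open>The polynomial ring and the free algebra\<close>

definition sr_carrier :: "nat \<Rightarrow> 'k::field sr_poly set" where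
  "sr_carrier n = {p. \<forall>e \<in> Poly_Mapping.keys p. Poly_Mapping.keys e \<subseteq> Pow {1..n}}"

lemma sr_poly_ring_eq: "sr_poly_ring n = ring_of_type_algebra\<lparr>carrier := sr_carrier n\<rparr>"
  by (simp add: sr_poly_ring_def sr_carrier_def)

definition free_carrier :: "nat \<Rightarrow> 'k::field free_alg set" where
  "free_carrier n = {f. \<forall>w \<in> Poly_Mapping.keys f. set (letters w) \<subseteq> {1..<n}}"

lemma free_algebra_eq: "free_algebra n = ring_of_type_algebra\<lparr>carrier := free_carrier n\<rparr>"
  by (simp add: free_algebra_def free_carrier_def)

text \<open>Natural number exponents cannot cancel, so multiplying monomials never shrinks the
  support.\<close>

lemma keys_add_nat:
  fixes e e' :: "'a \<Rightarrow>\<^sub>0 nat"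
  shows "Poly_Mapping.keys (e + e') = Poly_Mapping.keys e \<union> Poly_Mapping.keys e'"
  by (auto simp: in_keys_iff lookup_add)

lemma sr_poly_ring_cring: "cring (sr_poly_ring n :: 'k::field sr_poly ring)"
proof -
  have "ring (sr_poly_ring n :: 'k sr_poly ring)"
    unfolding sr_poly_ring_eq
  proof (rule subalgebra_ring)
    fix x y :: "'k sr_poly"
    assume "x \<in> sr_carrier n" "y \<in> sr_carrier n"
    then show "x + y \<in> sr_carrier n" "x * y \<in> sr_carrier n"
      using Poly_Mapping.keys_add[of x y] keys_mult[of x y]
      by (fastforce simp: sr_carrier_def keys_add_nat)+
  qed (auto simp: sr_carrier_def)
  then interpret ring "sr_poly_ring n :: 'k sr_poly ring" .
  show ?thesis
    by unfold_locales (simp add: sr_poly_ring_eq mult.commute)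
qed

lemma free_algebra_ring: "ring (free_algebra n :: 'k::field free_alg ring)"
  unfolding free_algebra_eq
proof (rule subalgebra_ring)
  fix x y :: "'k free_alg"
  assume "x \<in> free_carrier n" "y \<in> free_carrier n"
  then show "x + y \<in> free_carrier n" "x * y \<in> free_carrier n"
    using Poly_Mapping.keys_add[of x y] keys_mult[of x y]
    by (fastforce simp: free_carrier_def plus_free_monoid_def)+
qed (auto simp: free_carrier_def zero_free_monoid_def)

lemmas sr_poly_ring_ring = cring.axioms(1)[OF sr_poly_ring_cring]

lemma sr_carrier_mono: "n \<le> m \<Longrightarrow> sr_carrier n \<subseteq> sr_carrier m"
  by (force simp: sr_carrier_def)

lemma free_carrier_mono: "n \<le> m \<Longrightarrow> free_carrier n \<subseteq> free_carrier m"
  by (force simp: free_carrier_def)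

lemma word_in_free_carrier [simp]: "word is \<in> free_carrier n \<longleftrightarrow> set is \<subseteq> {1..<n}"
  by (simp add: free_carrier_def word_def)

lemma single_in_sr_carrier [simp]:
  "Poly_Mapping.single e c \<in> sr_carrier n \<longleftrightarrow> c = 0 \<or> Poly_Mapping.keys e \<subseteq> Pow {1..n}"
  by (simp add: sr_carrier_def)

lemma sr_carrier_ops:
  fixes p q :: "'k::field sr_poly"
  shows "0 \<in> (sr_carrier n :: 'k sr_poly set)"
  "1 \<in> (sr_carrier n :: 'k sr_poly set)"
  "p \<in> sr_carrier n \<Longrightarrow> q \<in> sr_carrier n \<Longrightarrow> p + q \<in> sr_carrier n"
  "p \<in> sr_carrier n \<Longrightarrow> q \<in> sr_carrier n \<Longrightarrow> p * q \<in> sr_carrier n"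
  "scalar c \<in> (sr_carrier n :: 'k sr_poly set)"
proof -
  interpret ring "sr_poly_ring n :: 'k sr_poly ring" by (rule sr_poly_ring_ring)
  show "0 \<in> (sr_carrier n :: 'k sr_poly set)" "1 \<in> (sr_carrier n :: 'k sr_poly set)"
    "scalar c \<in> (sr_carrier n :: 'k sr_poly set)"
    by (auto simp: sr_carrier_def scalar_def)
  assume "p \<in> sr_carrier n" "q \<in> sr_carrier n"
  then show "p + q \<in> sr_carrier n" "p * q \<in> sr_carrier n"
    using a_closed[of p q] m_closed[of p q] by (simp_all add: sr_poly_ring_eq)
qed

section \<open>The representation of the free algebra and its kernel\<close>

definition alg_op :: "'k::field free_alg \<Rightarrow> 'k sr_poly \<Rightarrow> 'k sr_poly" where
  "alg_op a p = lin (\<lambda>w. foldr pi_op (letters w) p) a"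

lemma foldr_pi_op_add: "foldr pi_op is (p + q) = foldr pi_op is p + foldr pi_op is q"
  by (induction "is") (simp_all add: pi_op_add)

lemma foldr_pi_op_scale: "foldr pi_op is (scalar c * p) = scalar c * foldr pi_op is p"
  by (induction "is") (simp_all add: pi_op_scale)

lemma alg_op_add_left: "alg_op (a + b) p = alg_op a p + alg_op b p"
  by (simp add: alg_op_def lin_add)

lemma alg_op_diff_left: "alg_op (a - b) p = alg_op a p - alg_op b p"
  by (simp add: alg_op_def lin_diff)

lemma alg_op_0_left [simp]: "alg_op 0 p = 0"
  by (simp add: alg_op_def)

lemma alg_op_word: "alg_op (word is) p = foldr pi_op is p"
  by (simp add: alg_op_def word_def lin_single)

lemma alg_op_add: "alg_op a (p + q) = alg_op a p + alg_op a q"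
  by (simp add: alg_op_def foldr_pi_op_add lin_fun_add)

lemma alg_op_scale: "alg_op a (scalar c * p) = scalar c * alg_op a p"
  by (simp add: alg_op_def foldr_pi_op_scale lin_fun_scale)

lemma alg_op_0 [simp]: "alg_op a 0 = 0"
  using alg_op_add[of a 0 0] by simp

text \<open>Both sides are additive in \<open>b\<close> and in \<open>a\<close>, which leaves single
  words. With \<open>foldr\<close> the leftmost letter acts last, so concatenation of words becomes
  composition of operators.\<close>

lemma alg_op_mult: "alg_op (a * b) p = alg_op a (alg_op b p)"
proof (rule poly_mapping_additive_eqI[where p = b])
  fix w d
  show "alg_op (a * Poly_Mapping.single w d) p = alg_op a (alg_op (Poly_Mapping.single w d) p)"
    by (rule poly_mapping_additive_eqI[where p = a])
      (simp_all add: distrib_right mult_single alg_op_def lin_single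
        lin_add plus_free_monoid_def foldr_pi_op_scale scalar_mult mult.assoc)
qed (simp_all add: alg_op_add_left alg_op_add distrib_left)

lemma alg_op_hecke_relation:
  assumes "a \<in> hecke_relations n"
  shows "alg_op a p = 0"
proof -
  \<comment> \<open>The relation allows either order of \<open>i\<close> and \<open>j\<close>,
    whereas the operator lemma is stated for the smaller index first.\<close>
  have comm: "pi_op i (pi_op j p) = pi_op j (pi_op i p)" if "\<bar>int i - int j\<bar> > 1" for i j
    using that pi_op_commute[of i j p] pi_op_commute[of j i p] by (cases "i < j") auto
  show ?thesis
    using assms pi_op_braid[of _ p] comm unfolding hecke_relations_def
    by (auto simp: alg_op_diff_left alg_op_word pi_op_idem)
qed

lemma hecke_relations_subset: "hecke_relations n \<subseteq> (free_carrier n :: 'k::field free_alg set)"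
proof -
  have "x - y \<in> free_carrier n" if "x \<in> free_carrier n" "y \<in> free_carrier n" for x y :: "'k free_alg"
    using that keys_diff[of x y] by (auto simp: free_carrier_def)
  then show ?thesis
    by (auto simp: hecke_relations_def)
qed

lemma hecke_ideal: "ideal (hecke_ideal n :: 'k::field free_alg set) (free_algebra n)"
proof -
  interpret ring "free_algebra n :: 'k free_alg ring" by (rule free_algebra_ring)
  show ?thesis
    unfolding hecke_ideal_def
    by (rule genideal_ideal) (use hecke_relations_subset in \<open>simp add: free_algebra_eq\<close>)
qed

text \<open>The elements annihilating every polynomial form a two-sided ideal containing the
  relations. Quantifying over all polynomials is what gives closure under right
  multiplication.\<close>

lemma alg_op_hecke_ideal:
  fixes a :: "'k::field free_alg"
  assumes "a \<in> hecke_ideal n"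
  shows "alg_op a p = 0"
proof -
  interpret ring "free_algebra n :: 'k free_alg ring" by (rule free_algebra_ring)
  let ?K = "{a \<in> free_carrier n. \<forall>p :: 'k sr_poly. alg_op a p = 0}"
  have "ideal ?K (free_algebra n)"
    using a_closed m_closed zero_closed ring_axioms unfolding free_algebra_eq
    by (intro subalgebra_idealI) (auto simp: alg_op_add_left alg_op_mult)
  then have "hecke_ideal n \<subseteq> ?K"
    unfolding hecke_ideal_def
    by (rule genideal_minimal) (use hecke_relations_subset alg_op_hecke_relation in auto)
  then show ?thesis
    using assms by blast
qed

section \<open>Polynomial rings preserved by the operators\<close>

lemma lin_closed:
  assumes "\<And>e. e \<in> Poly_Mapping.keys p \<Longrightarrow> f e \<in> S" "0 \<in> S"
    "\<And>x y. x \<in> S \<Longrightarrow> y \<in> S \<Longrightarrow> x + y \<in> S" "\<And>c x. x \<in> S \<Longrightarrow> scalar c * x \<in> S"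
  shows "lin f p \<in> S"
proof -
  have "(\<Sum>e\<in>T. scalar (Poly_Mapping.lookup p e) * f e) \<in> S"
    if "finite T" "T \<subseteq> Poly_Mapping.keys p" for T
    using that by (induction T rule: finite_induct) (auto intro: assms)
  then show ?thesis
    by (simp add: lin_def)
qed

lemma pi_monomial_closed:
  assumes "i \<in> {1..<n}" "Poly_Mapping.keys e \<subseteq> Pow {1..n}"
  shows "pi_monomial i e \<in> sr_carrier n"
proof -
  \<comment> \<open>Since \<open>i < n\<close>, both exchanged elements lie in
    \<open>{1..n}\<close>.\<close>
  have "transpose i (i + 1) ` A \<subseteq> {1..n}" if "A \<subseteq> {1..n}" for A
    using that assms(1) by (force simp: transpose_def)
  then have "Poly_Mapping.keys (swap_exponent i e) \<subseteq> Pow {1..n}"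
    using assms(2) unfolding keys_swap_exponent by blast
  then show ?thesis
    using assms(2) by (auto simp: pi_monomial_def sr_carrier_ops)
qed

lemma pi_op_closed:
  assumes "i \<in> {1..<n}" "p \<in> sr_carrier n"
  shows "pi_op i p \<in> sr_carrier n"
  unfolding pi_op_def
proof (rule lin_closed)
  show "pi_monomial i e \<in> sr_carrier n" if "e \<in> Poly_Mapping.keys p" for e
    using assms that by (intro pi_monomial_closed) (auto simp: sr_carrier_def)
qed (simp_all add: sr_carrier_ops)

lemma alg_op_closed:
  assumes "a \<in> free_carrier n" "p \<in> sr_carrier n"
  shows "alg_op a p \<in> sr_carrier n"
proof -
  have "foldr pi_op is p \<in> sr_carrier n" if "set is \<subseteq> {1..<n}" for "is"
    using that by (induction "is") (simp_all add: assms pi_op_closed)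
  then show ?thesis
    using assms unfolding alg_op_def
    by (intro lin_closed) (auto intro!: sr_carrier_ops simp: free_carrier_def)
qed

text \<open>No subset of \<open>{1..n}\<close> contains \<open>j\<close> or \<open>j + 1\<close>, so
  these indices are never separated. This is what makes the relation \<open>x ~ x pi_j\<close>
  harmless on polynomials coming from \<open>[n]\<close>.\<close>

lemma pi_op_fixes:
  assumes "p \<in> sr_carrier n" "n < j"
  shows "pi_op j p = p"
proof -
  have "pi_monomial j e = Poly_Mapping.single e 1" if "e \<in> Poly_Mapping.keys p" for e
  proof -
    have "Poly_Mapping.keys e \<subseteq> Pow {1..n}"
      using assms that by (simp add: sr_carrier_def)
    then have "\<not> separates e (j + 1) j" "\<not> separates e j (j + 1)"
      using assms(2) by (fastforce simp: separates_def)+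
    then show ?thesis by (simp add: pi_monomial_def)
  qed
  then have "pi_op j p = lin (\<lambda>e. Poly_Mapping.single e 1) p"
    unfolding pi_op_def by (rule lin_cong)
  then show ?thesis by simp
qed

section \<open>The Stanley-Reisner ideals and their invariance\<close>

lemma sr_var_mult:
  "sr_var A * sr_var B = Poly_Mapping.single (Poly_Mapping.single A 1 + Poly_Mapping.single B 1) 1"
  by (simp add: sr_var_def mult_single)

definition sr_relations :: "nat \<Rightarrow> 'k::field sr_poly set" where
  "sr_relations n =
     {sr_var A * sr_var B | A B. A \<subseteq> {1..n} \<and> B \<subseteq> {1..n} \<and> \<not> A \<subseteq> B \<and> \<not> B \<subseteq> A}"

lemma sr_ideal_eq: "sr_ideal n = Idl\<^bsub>sr_poly_ring n\<^esub> (sr_relations n)"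
  by (simp add: sr_ideal_def sr_relations_def)

lemma sr_relations_subset: "sr_relations n \<subseteq> sr_carrier n"
  by (auto simp: sr_relations_def sr_var_mult sr_carrier_ops keys_add_nat)

lemma sr_ideal: "ideal (sr_ideal n :: 'k::field sr_poly set) (sr_poly_ring n)"
proof -
  interpret ring "sr_poly_ring n :: 'k sr_poly ring" by (rule sr_poly_ring_ring)
  show ?thesis
    unfolding sr_ideal_eq
    by (rule genideal_ideal) (use sr_relations_subset in \<open>simp add: sr_poly_ring_eq\<close>)
qed

lemma sr_ideal_ops:
  "sr_ideal n \<subseteq> (sr_carrier n :: 'k::field sr_poly set)"
  "0 \<in> (sr_ideal n :: 'k sr_poly set)"
  "p \<in> (sr_ideal n :: 'k sr_poly set) \<Longrightarrow> q \<in> sr_ideal n \<Longrightarrow> p + q \<in> sr_ideal n"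
  "r \<in> sr_carrier n \<Longrightarrow> p \<in> (sr_ideal n :: 'k sr_poly set) \<Longrightarrow> r * p \<in> sr_ideal n"
proof -
  interpret ideal "sr_ideal n :: 'k sr_poly set" "sr_poly_ring n" by (rule sr_ideal)
  show "sr_ideal n \<subseteq> (sr_carrier n :: 'k sr_poly set)" "0 \<in> (sr_ideal n :: 'k sr_poly set)"
    using a_subset additive_subgroup.zero_closed[OF is_additive_subgroup] by (simp_all add: sr_poly_ring_eq)
  show "p \<in> (sr_ideal n :: 'k sr_poly set) \<Longrightarrow> q \<in> sr_ideal n \<Longrightarrow> p + q \<in> sr_ideal n"
    "r \<in> sr_carrier n \<Longrightarrow> p \<in> (sr_ideal n :: 'k sr_poly set) \<Longrightarrow> r * p \<in> sr_ideal n"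
    using additive_subgroup.a_closed[OF is_additive_subgroup, of p q] I_l_closed[of p r]
    by (simp_all add: sr_poly_ring_eq)
qed

text \<open>The larger ideal intersected with the smaller ring is an ideal there and contains the
  smaller generators. Thus the inclusion of polynomial rings descends to the quotients.\<close>

lemma sr_ideal_mono:
  assumes "n \<le> m"
  shows "(sr_ideal n :: 'k::field sr_poly set) \<subseteq> sr_ideal m"
proof -
  interpret ring "sr_poly_ring n :: 'k sr_poly ring" by (rule sr_poly_ring_ring)
  have "ideal (sr_ideal m \<inter> sr_carrier n :: 'k sr_poly set) (sr_poly_ring n)"
    unfolding sr_poly_ring_eq
  proof (rule subalgebra_idealI)
    show "ring (ring_of_type_algebra\<lparr>carrier := sr_carrier n :: 'k sr_poly set\<rparr>)"
      using ring_axioms by (simp add: sr_poly_ring_eq)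
    show "a * x \<in> sr_ideal m \<inter> sr_carrier n" "x * a \<in> sr_ideal m \<inter> sr_carrier n"
      if "a \<in> sr_carrier n" "x \<in> sr_ideal m \<inter> sr_carrier n" for a x :: "'k sr_poly"
      using that sr_carrier_mono[OF assms] sr_ideal_ops(4)[of a m x] sr_carrier_ops(4)[of a n x]
      by (auto simp: mult.commute)
  qed (simp_all add: sr_ideal_ops(2,3) sr_carrier_ops(1,3))
  moreover have "sr_relations n \<subseteq> (sr_ideal m :: 'k sr_poly set)"
  proof -
    interpret Rm: ring "sr_poly_ring m :: 'k sr_poly ring" by (rule sr_poly_ring_ring)
    have "sr_relations n \<subseteq> (sr_relations m :: 'k sr_poly set)"
    proof
      fix p :: "'k sr_poly"
      assume "p \<in> sr_relations n"
      then obtain A B where "p = sr_var A * sr_var B" "A \<subseteq> {1..n}" "B \<subseteq> {1..n}"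
          "\<not> A \<subseteq> B" "\<not> B \<subseteq> A"
        unfolding sr_relations_def by blast
      moreover from this assms have "A \<subseteq> {1..m}" "B \<subseteq> {1..m}"
        by auto
      ultimately show "p \<in> sr_relations m"
        unfolding sr_relations_def mem_Collect_eq by (intro exI[of _ A] exI[of _ B] conjI)
    qed
    then show ?thesis
      using Rm.genideal_self[of "sr_relations m"] sr_relations_subset[of m]
      unfolding sr_ideal_eq by (auto simp: sr_poly_ring_eq)
  qed
  ultimately have "sr_ideal n \<subseteq> (sr_ideal m \<inter> sr_carrier n :: 'k sr_poly set)"
    unfolding sr_ideal_eq[of n]
    by (intro genideal_minimal) (use sr_relations_subset in auto)
  then show ?thesis by blast
qed

lemma chain_exponent_addD: "chain_exponent (e + e') \<Longrightarrow> chain_exponent e'"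
  unfolding chain_exponent_def keys_add_nat by blast

lemma keys_mult_nonchain:
  assumes "\<forall>e\<in>Poly_Mapping.keys x. \<not> chain_exponent e"
    and e: "e \<in> Poly_Mapping.keys (a * x)"
  shows "\<not> chain_exponent e"
proof -
  obtain d d' where "e = d + d'" "d' \<in> Poly_Mapping.keys x"
    using e keys_mult[of a x] by blast
  then show ?thesis
    using assms(1) chain_exponent_addD by blast
qed

lemma sr_relations_nonchain:
  assumes "q \<in> sr_relations n" "e \<in> Poly_Mapping.keys q"
  shows "\<not> chain_exponent e"
proof -
  obtain A B where AB: "q = sr_var A * sr_var B" "\<not> A \<subseteq> B" "\<not> B \<subseteq> A"
    using assms(1) unfolding sr_relations_def by blast
  then have "A \<in> Poly_Mapping.keys e" "B \<in> Poly_Mapping.keys e"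
    using assms(2) by (simp_all add: sr_var_mult keys_add_nat)
  then show ?thesis
    using AB(2,3) unfolding chain_exponent_def by blast
qed

text \<open>Polynomials with no chain-supported monomial are closed under multiplication by
  arbitrary polynomials, because multiplication only enlarges supports. They contain the generators,
  hence the ideal.\<close>

lemma keys_sr_ideal:
  fixes p :: "'k::field sr_poly"
  assumes "p \<in> sr_ideal n" "e \<in> Poly_Mapping.keys p"
  shows "\<not> chain_exponent e"
proof -
  interpret ring "sr_poly_ring n :: 'k sr_poly ring" by (rule sr_poly_ring_ring)
  define N where "N = {p :: 'k sr_poly. \<forall>e\<in>Poly_Mapping.keys p. \<not> chain_exponent e}"
  have mult: "a * x \<in> N" if "x \<in> N" for a x
    using that keys_mult_nonchain[of x _ a] unfolding N_def mem_Collect_eq by blast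
  have add: "x + y \<in> N" if "x \<in> N" "y \<in> N" for x y
    using that subsetD[OF Poly_Mapping.keys_add, of _ x y] unfolding N_def mem_Collect_eq by blast
  have "ideal (N \<inter> sr_carrier n) (sr_poly_ring n)"
    unfolding sr_poly_ring_eq
  proof (rule subalgebra_idealI)
    show "ring (ring_of_type_algebra\<lparr>carrier := sr_carrier n :: 'k sr_poly set\<rparr>)"
      using ring_axioms by (simp add: sr_poly_ring_eq)
    show "a * x \<in> N \<inter> sr_carrier n" "x * a \<in> N \<inter> sr_carrier n"
      if "a \<in> sr_carrier n" "x \<in> N \<inter> sr_carrier n" for a x
      using that mult[of x a] sr_carrier_ops(4)[of a n x] by (simp_all add: mult.commute)
  qed (simp_all add: add sr_carrier_ops, simp add: N_def)
  moreover have "sr_relations n \<subseteq> N"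
    unfolding N_def by (intro subsetI CollectI ballI) (rule sr_relations_nonchain)
  then have "sr_relations n \<subseteq> N \<inter> sr_carrier n"
    by (simp add: sr_relations_subset)
  ultimately have "sr_ideal n \<subseteq> N \<inter> sr_carrier n"
    unfolding sr_ideal_eq by (rule genideal_minimal)
  then show ?thesis
    using assms unfolding N_def by blast
qed

text \<open>Every monomial of \<open>p\<close> is supported off chains, so each generator fixes
  \<open>p\<close>; the whole operator therefore returns a combination of copies of
  \<open>p\<close>.\<close>

lemma alg_op_sr_ideal:
  assumes "p \<in> sr_ideal n"
  shows "alg_op a p \<in> sr_ideal n"
proof -
  have "pi_op i p = p" for i
  proof -
    have "pi_op i p = lin (\<lambda>e. Poly_Mapping.single e 1) p"
      unfolding pi_op_def
      by (rule lin_cong) (use keys_sr_ideal[OF assms] in \<open>simp add: pi_monomial_def\<close>)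
    then show ?thesis by simp
  qed
  then have "foldr pi_op is p = p" for "is"
    by (induction "is") simp_all
  then show ?thesis
    unfolding alg_op_def
    by (intro lin_closed) (simp_all add: assms sr_ideal_ops(2-4) sr_carrier_ops(5))
qed

section \<open>The functor\<close>

lemma sr_class_eqI:
  fixes p q :: "'k::field sr_poly"
  assumes "q \<in> sr_carrier n" "p - q \<in> sr_ideal n"
  shows "sr_class n p = sr_class n q"
proof -
  interpret ideal "sr_ideal n :: 'k sr_poly set" "sr_poly_ring n" by (rule sr_ideal)
  have "p \<in> sr_ideal n +>\<^bsub>sr_poly_ring n\<^esub> q"
    using assms(2) by (auto simp: a_r_coset_def' sr_poly_ring_eq intro!: bexI[of _ "p - q"])
  then show ?thesis
    unfolding sr_class_def
    using a_repr_independence[of p "sr_ideal n" q] assms(1) a_subgroup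
    by (simp add: sr_poly_ring_eq)
qed

lemma sr_class_diff:
  fixes p q :: "'k::field sr_poly"
  assumes "p \<in> sr_class n q"
  shows "p - q \<in> sr_ideal n"
  using assms by (auto simp: sr_class_def a_r_coset_def' sr_poly_ring_eq)

lemma sr_class_nonempty: "sr_class n p \<noteq> {}"
  using sr_ideal_ops(2) by (auto simp: sr_class_def a_r_coset_def')

text \<open>Coset operations are reduced to operations on representatives. Scalar multiplication is
  a product with the class of a constant, hence a case of coset multiplication.\<close>

lemma stanley_reisner_simps:
  fixes p q :: "'k::field sr_poly"
  shows "carrier (stanley_reisner n) = sr_class n ` (sr_carrier n :: 'k sr_poly set)"
    and "\<zero>\<^bsub>stanley_reisner n\<^esub> = sr_class n (0 :: 'k sr_poly)"
    and "p \<in> sr_carrier n \<Longrightarrow> q \<in> sr_carrier n \<Longrightarrow>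
      sr_class n p \<oplus>\<^bsub>stanley_reisner n\<^esub> sr_class n q = sr_class n (p + q)"
    and "p \<in> sr_carrier n \<Longrightarrow> c \<odot>\<^bsub>stanley_reisner n\<^esub> sr_class n p = sr_class n (scalar c * p)"
proof -
  interpret ideal "sr_ideal n :: 'k sr_poly set" "sr_poly_ring n" by (rule sr_ideal)
  note defs = stanley_reisner_def Let_def ring.defs module.defs FactRing_def sr_class_def
  show "carrier (stanley_reisner n) = sr_class n ` (sr_carrier n :: 'k sr_poly set)"
    by (auto simp: defs A_RCOSETS_def' sr_poly_ring_eq)
  show "\<zero>\<^bsub>stanley_reisner n\<^esub> = sr_class n (0 :: 'k sr_poly)"
    using a_coset_add_zero[OF a_subset] by (simp add: defs sr_poly_ring_eq)
  show "sr_class n p \<oplus>\<^bsub>stanley_reisner n\<^esub> sr_class n q = sr_class n (p + q)"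
    if "p \<in> sr_carrier n" "q \<in> sr_carrier n"
    using a_rcos_sum[of p q] that by (simp add: defs sr_poly_ring_eq)
  show "c \<odot>\<^bsub>stanley_reisner n\<^esub> sr_class n p = sr_class n (scalar c * p)" if "p \<in> sr_carrier n"
    using rcoset_mult_add[of "scalar c" p] that sr_carrier_ops(5)[of c n]
    by (simp add: defs sr_poly_ring_eq flip: scalar_def)
qed

lemma stanley_reisner_abelian_group:
  "abelian_group (stanley_reisner n :: ('k::field, 'k sr_poly set) module)"
proof (rule abelian_groupI)
  let ?V = "stanley_reisner n :: ('k, 'k sr_poly set) module"
  note simps = stanley_reisner_simps(1-3) sr_carrier_ops(1,3) ac_simps
  show "\<zero>\<^bsub>?V\<^esub> \<in> carrier ?V"
    by (simp add: simps)
  fix x y z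
  assume "x \<in> carrier ?V"
  then obtain p where p: "p \<in> sr_carrier n" "x = sr_class n p"
    by (auto simp: stanley_reisner_simps(1))
  then show "\<zero>\<^bsub>?V\<^esub> \<oplus>\<^bsub>?V\<^esub> x = x"
    by (simp add: simps)
  have "scalar (- 1) * p \<in> sr_carrier n"
    using p(1) by (simp add: sr_carrier_ops)
  moreover have "scalar (- 1) * p + p = 0"
    using scalar_add[of "- 1 :: 'k" 1] distrib_right[of "scalar (- 1)" 1 p] by simp
  ultimately show "\<exists>y\<in>carrier ?V. y \<oplus>\<^bsub>?V\<^esub> x = \<zero>\<^bsub>?V\<^esub>"
    using p by (intro bexI[of _ "sr_class n (scalar (- 1) * p)"]) (simp_all add: stanley_reisner_simps)
  assume "y \<in> carrier ?V"
  then obtain q where q: "q \<in> sr_carrier n" "y = sr_class n q"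
    by (auto simp: stanley_reisner_simps(1))
  show "x \<oplus>\<^bsub>?V\<^esub> y \<in> carrier ?V" "x \<oplus>\<^bsub>?V\<^esub> y = y \<oplus>\<^bsub>?V\<^esub> x"
    using p q by (simp_all add: simps)
  assume "z \<in> carrier ?V"
  then obtain r where r: "r \<in> sr_carrier n" "z = sr_class n r"
    by (auto simp: stanley_reisner_simps(1))
  show "x \<oplus>\<^bsub>?V\<^esub> y \<oplus>\<^bsub>?V\<^esub> z = x \<oplus>\<^bsub>?V\<^esub> (y \<oplus>\<^bsub>?V\<^esub> z)"
    using p q r by (simp add: simps)
qed

lemma stanley_reisner_module:
  "Module.module ring_of_type_algebra (stanley_reisner n :: ('k::field, 'k sr_poly set) module)"
proof (rule moduleI[OF cring_from_type_algebra stanley_reisner_abelian_group])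
  let ?V = "stanley_reisner n :: ('k, 'k sr_poly set) module"
  fix c d :: 'k and x y
  assume "x \<in> carrier ?V"
  then obtain p where p: "p \<in> sr_carrier n" "x = sr_class n p"
    by (auto simp: stanley_reisner_simps(1))
  have scaled: "scalar e * p \<in> sr_carrier n" for e
    using p(1) by (simp add: sr_carrier_ops)
  show "c \<odot>\<^bsub>?V\<^esub> x \<in> carrier ?V"
    by (simp add: p stanley_reisner_simps(1,4) scaled)
  show "(c \<oplus>\<^bsub>ring_of_type_algebra\<^esub> d) \<odot>\<^bsub>?V\<^esub> x = c \<odot>\<^bsub>?V\<^esub> x \<oplus>\<^bsub>?V\<^esub> d \<odot>\<^bsub>?V\<^esub> x"
    by (simp add: p stanley_reisner_simps(3,4) scaled scalar_add distrib_right)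
  show "(c \<otimes>\<^bsub>ring_of_type_algebra\<^esub> d) \<odot>\<^bsub>?V\<^esub> x = c \<odot>\<^bsub>?V\<^esub> (d \<odot>\<^bsub>?V\<^esub> x)"
    by (simp add: p stanley_reisner_simps(4) scaled scalar_mult mult.assoc)
  show "\<one>\<^bsub>ring_of_type_algebra\<^esub> \<odot>\<^bsub>?V\<^esub> x = x"
    by (simp add: p stanley_reisner_simps(4))
  assume "y \<in> carrier ?V"
  then obtain q where q: "q \<in> sr_carrier n" "y = sr_class n q"
    by (auto simp: stanley_reisner_simps(1))
  then have "scalar e * q \<in> sr_carrier n" for e
    by (simp add: sr_carrier_ops)
  then show "c \<odot>\<^bsub>?V\<^esub> (x \<oplus>\<^bsub>?V\<^esub> y) = c \<odot>\<^bsub>?V\<^esub> x \<oplus>\<^bsub>?V\<^esub> c \<odot>\<^bsub>?V\<^esub> y"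
    by (simp add: p q stanley_reisner_simps(3,4) scaled sr_carrier_ops(3) distrib_left)
qed

section \<open>Cosets acting by a prescribed operator\<close>

text \<open>
  Working with all elements of a set at once makes it unnecessary to know that the sets involved
  are classes of elements of the 0-Hecke monoid, so Matsumoto's theorem is not needed.
\<close>

definition acts_as ::
    "nat \<Rightarrow> nat \<Rightarrow> ('k::field sr_poly \<Rightarrow> 'k sr_poly) \<Rightarrow> 'k free_alg set \<Rightarrow> bool" where
  "acts_as n m F x \<longleftrightarrow> x \<noteq> {} \<and>
     (\<forall>a\<in>x. a \<in> free_carrier m \<and> (\<forall>p\<in>sr_carrier n. alg_op a p = F p))"

text \<open>The Hecke ideal acts as zero, so an operator does not depend on the representative of a
  coset.\<close>

lemma coset_alg_op:
  assumes "c \<in> hecke_ideal m +>\<^bsub>free_algebra m\<^esub> b"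
  shows "alg_op c p = alg_op b p"
  using assms by (auto simp: a_r_coset_def' free_algebra_eq alg_op_add_left alg_op_hecke_ideal)

lemma hecke_coset:
  fixes b :: "'k::field free_alg"
  assumes "b \<in> free_carrier m"
  shows "b \<in> hecke_ideal m +>\<^bsub>free_algebra m\<^esub> b"
    and "hecke_ideal m +>\<^bsub>free_algebra m\<^esub> b \<subseteq> free_carrier m"
proof -
  interpret ideal "hecke_ideal m :: 'k free_alg set" "free_algebra m" by (rule hecke_ideal)
  show "b \<in> hecke_ideal m +>\<^bsub>free_algebra m\<^esub> b"
    using a_rcos_self[of b] assms by (simp add: free_algebra_eq)
  show "hecke_ideal m +>\<^bsub>free_algebra m\<^esub> b \<subseteq> free_carrier m"
    using a_r_coset_subset_G[OF a_subset, of b] assms by (simp add: free_algebra_eq)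
qed

lemma acts_as_coset:
  assumes "b \<in> free_carrier m"
  shows "acts_as n m F (hecke_ideal m +>\<^bsub>free_algebra m\<^esub> b) \<longleftrightarrow>
     (\<forall>p\<in>sr_carrier n. alg_op b p = F p)"
proof -
  let ?x = "hecke_ideal m +>\<^bsub>free_algebra m\<^esub> b"
  have "?x \<noteq> {}" "a \<in> free_carrier m" "alg_op a p = alg_op b p" if "a \<in> ?x" for a p
    using that hecke_coset(2)[OF assms] coset_alg_op[of a m b] by auto
  with hecke_coset(1)[OF assms] show ?thesis
    unfolding acts_as_def by metis
qed

lemma hecke_word_mult:
  assumes "set is \<subseteq> {1..<m}" "set js \<subseteq> {1..<m}"
  shows "(hecke_word m is :: 'k::field free_alg set) \<otimes>\<^bsub>hecke_algebra m\<^esub> hecke_word m js =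
    hecke_word m (is @ js)"
proof -
  interpret ideal "hecke_ideal m :: 'k free_alg set" "free_algebra m" by (rule hecke_ideal)
  have "word is * word js = (word (is @ js) :: 'k free_alg)"
    by (simp add: word_def mult_single plus_free_monoid_def)
  moreover have "word is \<in> carrier (free_algebra m :: 'k free_alg ring)"
    "word js \<in> carrier (free_algebra m :: 'k free_alg ring)"
    using assms by (simp_all add: free_algebra_eq)
  ultimately show ?thesis
    using rcoset_mult_add[of "word is" "word js"]
    by (simp add: hecke_word_def hecke_algebra_def FactRing_def free_algebra_eq)
qed

lemma acts_as_hecke_word:
  "set is \<subseteq> {1..<m} \<Longrightarrow>
    acts_as n m F (hecke_word m is) \<longleftrightarrow> (\<forall>p\<in>sr_carrier n. foldr pi_op is p = F p)"
  by (simp add: hecke_word_def acts_as_coset alg_op_word)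

lemma hecke_equiv_acts_as:
  assumes "hecke_equiv n m x z" "acts_as n m F x"
  shows "acts_as n m F z"
  using assms(1) unfolding hecke_equiv_def
proof (induction rule: equivclp_induct)
  case base
  show ?case by (rule assms(2))
next
  case (step y z)
  \<comment> \<open>Steps of the equivalence closure may be taken in either direction, hence the
    biconditional. Right multiplication appends a letter that is applied first, and on
    \<open>sr_carrier n\<close> this letter acts trivially.\<close>
  have "acts_as n m F u \<longleftrightarrow> acts_as n m F (u \<otimes>\<^bsub>hecke_algebra m\<^esub> hecke_word m [j])"
    if u: "u \<in> hecke_monoid m" and j: "j \<in> {n + 1..<m}" for u j
  proof -
    obtain ks where ks: "set ks \<subseteq> {1..<m}" "u = hecke_word m ks"
      using u by (auto simp: hecke_monoid_def reduced_expression_def)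
    have "pi_op j p = p" if "p \<in> sr_carrier n" for p :: "'a sr_poly"
      using pi_op_fixes[of p n j] that j by simp
    then show ?thesis
      using ks j by (simp add: hecke_word_mult acts_as_hecke_word)
  qed
  then show ?case
    using step by blast
qed

section \<open>The action of morphisms and its functoriality\<close>

definition hecke_act ::
    "nat \<Rightarrow> nat \<Rightarrow> 'k::field free_alg set set \<Rightarrow> 'k sr_poly set \<Rightarrow> 'k sr_poly set" where
  "hecke_act n m f v = sr_class m (alg_op (SOME a. a \<in> \<Union>f) (SOME p. p \<in> v))"

text \<open>Both choices in \<open>hecke_act\<close> are immaterial: every available algebra element
  acts as \<open>F\<close> on \<open>p\<close>, and another representative of the class of
  \<open>p\<close> differs by an ideal element, which the operator keeps in the ideal.\<close>

lemma hecke_act_sr_class: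
  fixes f :: "'k::field free_alg set set"
  assumes "n \<le> m" "f \<noteq> {}" "\<And>x. x \<in> f \<Longrightarrow> acts_as n m F x" "p \<in> sr_carrier n"
  shows "hecke_act n m f (sr_class n p) = sr_class m (F p)"
proof -
  define a where "a = (SOME a. a \<in> \<Union>f)"
  define q where "q = (SOME q. q \<in> sr_class n p)"
  have "\<exists>a. a \<in> \<Union>f"
    using assms(2,3) by (force simp: acts_as_def)
  then have "a \<in> \<Union>f"
    unfolding a_def by (rule someI_ex)
  then have a: "a \<in> free_carrier m" "alg_op a p = F p"
    using assms(3,4) by (auto simp: acts_as_def)
  have "q \<in> sr_class n p"
    unfolding q_def by (rule someI_ex) (use sr_class_nonempty in blast)
  then have "q - p \<in> sr_ideal m"
    using sr_class_diff sr_ideal_mono[OF assms(1)] by blast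
  then have "alg_op a (q - p) \<in> sr_ideal m"
    by (rule alg_op_sr_ideal)
  \<comment> \<open>\<open>F\<close> is prescribed only on \<open>sr_carrier n\<close> and need not
    be additive, so the splitting takes place in \<open>alg_op a\<close>.\<close>
  moreover have "alg_op a q = alg_op a (q - p) + alg_op a p"
    by (simp flip: alg_op_add)
  ultimately have "alg_op a q - F p \<in> sr_ideal m"
    by (simp add: a)
  moreover have "F p \<in> sr_carrier m"
    using alg_op_closed[OF a(1), of p] assms(4) sr_carrier_mono[OF assms(1)] a(2) by auto
  ultimately show ?thesis
    using sr_class_eqI[of "F p" m "alg_op a q"] by (simp add: hecke_act_def a_def q_def)
qed

lemma hecke_class_self: "x \<in> hecke_class n m x"
  by (simp add: hecke_class_def hecke_equiv_def)

lemma hecke_class_acts_as: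
  "acts_as n m F x \<Longrightarrow> z \<in> hecke_class n m x \<Longrightarrow> acts_as n m F z"
  unfolding hecke_class_def using hecke_equiv_acts_as by blast

text \<open>A word for a monoid element representing \<open>f\<close> supplies one operator that all
  members of the class share.\<close>

lemma hecke_hom_acts_as:
  fixes f :: "'k::field free_alg set set"
  assumes "f \<in> hecke_hom n m"
  obtains a :: "'k free_alg" where "n \<le> m" "f \<noteq> {}" "a \<in> free_carrier m"
    "\<And>x. x \<in> f \<Longrightarrow> acts_as n m (alg_op a) x"
proof -
  obtain ks where ks: "n \<le> m" "set ks \<subseteq> {1..<m}" "f = hecke_class n m (hecke_word m ks)"
    using assms
    by (auto simp: hecke_hom_def hecke_monoid_def reduced_expression_def split: if_splits)
  show ?thesis
  proof (rule that[of "word ks"])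
    show "acts_as n m (alg_op (word ks)) x" if "x \<in> f" for x
      using that ks hecke_class_acts_as[of n m "alg_op (word ks)" "hecke_word m ks" x]
      by (simp add: acts_as_hecke_word alg_op_word)
    show "f \<noteq> {}"
      using hecke_class_self[of "hecke_word m ks" n m] unfolding ks(3) by blast
  qed (use ks in simp_all)
qed

text \<open>An element of the product is congruent to some \<open>a * b\<close> with
  \<open>a\<close> in \<open>y\<close> and \<open>b\<close> congruent to a member of
  \<open>x\<close>; it acts as \<open>a\<close> after that member.\<close>

lemma acts_as_comp:
  fixes x y :: "'k::field free_alg set"
  assumes "n \<le> m" "m \<le> l" "acts_as n m F x" "acts_as m l G y"
  shows "acts_as n l (G \<circ> F) (y \<otimes>\<^bsub>hecke_algebra l\<^esub> hecke_incl l x)"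
proof -
  let ?I = "hecke_ideal l :: 'k free_alg set"
  let ?z = "y \<otimes>\<^bsub>hecke_algebra l\<^esub> hecke_incl l x"
  have z: "?z = (\<Union>a\<in>y. \<Union>b\<in>hecke_incl l x. ?I +>\<^bsub>free_algebra l\<^esub> (a * b))"
    by (simp add: hecke_algebra_def FactRing_def rcoset_mult_def free_algebra_eq)
  have prod: "acts_as n l (G \<circ> F) (?I +>\<^bsub>free_algebra l\<^esub> (a * b))"
    if a: "a \<in> y" and b: "b \<in> hecke_incl l x" for a b
  proof -
    interpret ring "free_algebra l :: 'k free_alg ring" by (rule free_algebra_ring)
    obtain b' where b': "b' \<in> x" "b \<in> ?I +>\<^bsub>free_algebra l\<^esub> b'"
      using b by (auto simp: hecke_incl_def)
    then have "b' \<in> free_carrier m" and F: "\<And>p. p \<in> sr_carrier n \<Longrightarrow> alg_op b' p = F p"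
      using assms(3) by (auto simp: acts_as_def)
    then have "b \<in> free_carrier l"
      using b' free_carrier_mono[OF assms(2)] hecke_coset(2)[of b' l] by blast
    moreover have "a \<in> free_carrier l" and G: "\<And>p. p \<in> sr_carrier m \<Longrightarrow> alg_op a p = G p"
      using assms(4) a by (auto simp: acts_as_def)
    ultimately have "a * b \<in> free_carrier l"
      using m_closed[of a b] by (simp add: free_algebra_eq)
    moreover have "alg_op (a * b) p = G (F p)" if "p \<in> sr_carrier n" for p
    proof -
      \<comment> \<open>The behaviour of \<open>a\<close> is known only on
        \<open>sr_carrier m\<close>, so the intermediate value must be placed there before
        \<open>G\<close> can be substituted.\<close>
      have "F p \<in> sr_carrier m"
        using alg_op_closed[OF \<open>b' \<in> free_carrier m\<close>, of p] that sr_carrier_mono[OF assms(1)] F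
        by auto
      then show ?thesis
        using that by (simp add: alg_op_mult coset_alg_op[OF b'(2)] F G)
    qed
    ultimately show ?thesis
      by (simp add: acts_as_coset)
  qed
  have "y \<noteq> {}"
    using assms(4) by (simp add: acts_as_def)
  moreover have "hecke_incl l x \<noteq> {}"
    using assms(3) hecke_coset(1) free_carrier_mono[OF assms(2)]
    unfolding acts_as_def hecke_incl_def by blast
  ultimately obtain a b where "a \<in> y" "b \<in> hecke_incl l x"
    by blast
  then have "?z \<noteq> {}"
    using prod[of a b] unfolding z acts_as_def by auto
  moreover have "c \<in> free_carrier l \<and> (\<forall>p\<in>sr_carrier n. alg_op c p = (G \<circ> F) p)" if c: "c \<in> ?z" for c
  proof -
    obtain a b where "a \<in> y" "b \<in> hecke_incl l x" "c \<in> ?I +>\<^bsub>free_algebra l\<^esub> (a * b)"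
      using c unfolding z by (elim UN_E)
    then show ?thesis
      using prod[of a b] unfolding acts_as_def by blast
  qed
  ultimately show ?thesis
    unfolding acts_as_def by (intro conjI ballI) simp_all
qed

lemma hecke_iota_acts_as:
  fixes x :: "'k::field free_alg set"
  assumes "x \<in> hecke_iota n m"
  shows "acts_as n m id x"
proof -
  \<comment> \<open>The unit is the coset of the empty word, whose operator is the identity.\<close>
  have "\<one>\<^bsub>hecke_algebra m\<^esub> = (hecke_word m [] :: 'k free_alg set)"
    by (simp add: hecke_algebra_def FactRing_def hecke_word_def free_algebra_eq word_def
        flip: zero_free_monoid_def)
  then show ?thesis
    using assms hecke_class_acts_as[of n m id "hecke_word m []" x]
    by (simp add: hecke_iota_def acts_as_hecke_word)
qed

lemma hecke_module_hecke_act: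
  "hecke_module (stanley_reisner :: nat \<Rightarrow> ('k::field, 'k sr_poly set) module) hecke_act"
proof (rule hecke_module.intro)
  let ?V = "stanley_reisner :: nat \<Rightarrow> ('k, 'k sr_poly set) module"
  fix n m l and f g :: "'k free_alg set set" and v
  show "Module.module ring_of_type_algebra (?V n)"
    by (rule stanley_reisner_module)
  show "linear_map (?V n) (?V m) (hecke_act n m f)" if "f \<in> hecke_hom n m"
  proof -
    obtain a :: "'k free_alg" where a: "n \<le> m" "f \<noteq> {}" "a \<in> free_carrier m"
      "\<And>x. x \<in> f \<Longrightarrow> acts_as n m (alg_op a) x"
      using \<open>f \<in> hecke_hom n m\<close> by (rule hecke_hom_acts_as) blast
    have act: "hecke_act n m f (sr_class n p) = sr_class m (alg_op a p)" if "p \<in> sr_carrier n" for p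
      using a that by (intro hecke_act_sr_class) auto
    have closed: "alg_op a p \<in> sr_carrier m" if "p \<in> sr_carrier n" for p
      using that a(3) sr_carrier_mono[OF a(1)] by (intro alg_op_closed) auto
    show ?thesis
      unfolding linear_map_def
      by (auto simp: stanley_reisner_simps act closed sr_carrier_ops alg_op_add alg_op_scale)
  qed
  show "hecke_act n n (hecke_iota n n) v = v" if v: "v \<in> carrier (?V n)"
  proof -
    obtain p where p: "p \<in> sr_carrier n" "v = sr_class n p"
      using v by (auto simp: stanley_reisner_simps)
    have "hecke_act n n (hecke_iota n n) v = sr_class n (id p)"
      unfolding p(2)
    proof (rule hecke_act_sr_class)
      show "acts_as n n id x" if "x \<in> hecke_iota n n" for x :: "'k free_alg set"
        using that by (rule hecke_iota_acts_as)
      show "hecke_iota n n \<noteq> ({} :: 'k free_alg set set)"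
        unfolding hecke_iota_def using hecke_class_self by blast
    qed (use p in simp_all)
    then show ?thesis
      by (simp add: p)
  qed
  show "hecke_act n l (hecke_comp n m l g f) v = hecke_act m l g (hecke_act n m f v)"
    if f: "f \<in> hecke_hom n m" and g: "g \<in> hecke_hom m l" and v: "v \<in> carrier (?V n)"
  proof -
    obtain a :: "'k free_alg" where a: "n \<le> m" "f \<noteq> {}" "a \<in> free_carrier m"
      "\<And>x. x \<in> f \<Longrightarrow> acts_as n m (alg_op a) x"
      using f by (rule hecke_hom_acts_as) blast
    obtain b :: "'k free_alg" where b: "m \<le> l" "g \<noteq> {}" "b \<in> free_carrier l"
      "\<And>x. x \<in> g \<Longrightarrow> acts_as m l (alg_op b) x"
      using g by (rule hecke_hom_acts_as) blast
    obtain p where p: "p \<in> sr_carrier n" "v = sr_class n p"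
      using v by (auto simp: stanley_reisner_simps)
    have "alg_op a p \<in> sr_carrier m"
      using p(1) a(3) sr_carrier_mono[OF a(1)] by (intro alg_op_closed) auto
    then have "hecke_act m l g (hecke_act n m f v) = sr_class l (alg_op b (alg_op a p))"
      using a b p hecke_act_sr_class[of n m f "alg_op a" p]
        hecke_act_sr_class[of m l g "alg_op b" "alg_op a p"] by simp
    moreover have "hecke_act n l (hecke_comp n m l g f) (sr_class n p) =
        sr_class l ((alg_op b \<circ> alg_op a) p)"
    proof (rule hecke_act_sr_class)
      show "hecke_comp n m l g f \<noteq> {}"
        using a(2) b(2) hecke_class_self unfolding hecke_comp_def by blast
      \<comment> \<open>Each member of the composite is equivalent to a product of members of
        \<open>g\<close> and \<open>f\<close>, and the operator is invariant under that
        equivalence.\<close>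
      show "acts_as n l (alg_op b \<circ> alg_op a) z" if "z \<in> hecke_comp n m l g f" for z
        using that a b hecke_class_acts_as[OF acts_as_comp] unfolding hecke_comp_def by blast
    qed (use a b p in auto)
    ultimately show ?thesis
      using p by simp
  qed
qed

section \<open>Multichains\<close>

definition multichain_exponent :: "nat set list \<Rightarrow> nat set \<Rightarrow>\<^sub>0 nat" where
  "multichain_exponent M = sum_list (map (\<lambda>A. Poly_Mapping.single A 1) M)"

lemma prod_list_sr_var: "prod_list (map sr_var M) = Poly_Mapping.single (multichain_exponent M) 1"
  by (induction M) (simp_all add: multichain_exponent_def sr_var_def mult_single)

lemma keys_multichain_exponent: "Poly_Mapping.keys (multichain_exponent M) = set M"
  by (induction M) (simp_all add: multichain_exponent_def keys_add_nat)

lemma swap_multichain_exponent: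
  "swap_exponent i (multichain_exponent M) = multichain_exponent (chain_swap i M)"
proof (induction M)
  case Nil
  show ?case
    by (simp add: multichain_exponent_def chain_swap_def swap_exponent_def inj_image_transpose
        map_key_zero)
next
  case (Cons A M)
  have "swap_exponent i (Poly_Mapping.single A 1) =
      Poly_Mapping.single (transpose i (i + 1) ` A) (1 :: nat)"
    unfolding swap_exponent_def
    \<comment> \<open>The library rule computes the pullback of a single whose key is an image. The
      key is therefore taken to be the swapped set, whose image under the involution is
      \<open>A\<close>.\<close>
    using map_key_single[OF inj_image_transpose, of i "i + 1" "transpose i (i + 1) ` A" "1 :: nat"]
    by (simp add: image_comp)
  moreover have "swap_exponent i (e + e') = swap_exponent i e + swap_exponent i e'" for e e'
    unfolding swap_exponent_def by (rule map_key_plus[OF inj_image_transpose])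
  ultimately show ?case
    using Cons by (simp add: multichain_exponent_def chain_swap_def)
qed

lemma multichain_exponent_closed:
  assumes "multichain n M"
  shows "Poly_Mapping.single (multichain_exponent M) 1 \<in> sr_carrier n"
  using assms by (auto simp: multichain_def keys_multichain_exponent)

lemma multichain_swap:
  assumes "i \<in> {1..<n}" "multichain n M"
  shows "multichain n (chain_swap i M)"
proof -
  have "transpose i (i + 1) ` A \<subseteq> {1..n}" if "A \<subseteq> {1..n}" for A
    using that assms(1) by (force simp: transpose_def)
  moreover have "sorted_wrt (\<subseteq>) (chain_swap i M)"
    using assms(2) unfolding multichain_def chain_swap_def sorted_wrt_map
    by (simp add: inj_image_subset_iff)
  ultimately show ?thesis
    using assms(2) by (auto simp: multichain_def chain_swap_def)
qed

lemma chain_exponent_multichain: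
  assumes "multichain n M"
  shows "chain_exponent (multichain_exponent M)"
proof -
  have "sorted_wrt (\<subseteq>) N \<Longrightarrow> \<forall>A\<in>set N. \<forall>B\<in>set N. A \<subseteq> B \<or> B \<subseteq> A" for N :: "nat set list"
    by (induction N) auto
  then show ?thesis
    using assms unfolding multichain_def chain_exponent_def keys_multichain_exponent by blast
qed

section \<open>Positions in a multichain\<close>

lemma chain_entry_mono:
  assumes "multichain n M" "j \<le> k"
  shows "chain_entry n M j \<subseteq> chain_entry n M k"
proof (cases "j = 0 \<or> j = k \<or> length M < k")
  case True
  then show ?thesis
    using assms by (auto simp: chain_entry_def multichain_def)
next
  case False
  then have "j - 1 < k - 1" "k - 1 < length M"
    using assms(2) by auto
  then have "M ! (j - 1) \<subseteq> M ! (k - 1)"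
    using assms(1) by (auto simp: multichain_def sorted_wrt_iff_nth_less)
  then show ?thesis
    using False assms(2) by (simp add: chain_entry_def)
qed

text \<open>The final entry \<open>{1..n}\<close> makes the minimum exist, and monotonicity of the
  entries turns "some entry up to \<open>j\<close> contains \<open>i\<close>" into membership in
  entry \<open>j\<close>. For \<open>j = 0\<close> both sides fail.\<close>

lemma chain_pos_le_iff:
  assumes "multichain n M" "i \<in> {1..n}" "j \<le> length M + 1"
  shows "chain_pos n M i \<le> j \<longleftrightarrow> i \<in> chain_entry n M j"
proof -
  let ?J = "{j \<in> {1..length M + 1}. i \<in> chain_entry n M j}"
  have "length M + 1 \<in> ?J"
    using assms(2) by (simp add: chain_entry_def)
  then have "?J \<noteq> {}" by blast
  then have "chain_pos n M i \<le> j \<longleftrightarrow> (\<exists>k\<in>?J. k \<le> j)"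
    unfolding chain_pos_def by (intro Min_le_iff) simp_all
  also have "\<dots> \<longleftrightarrow> i \<in> chain_entry n M j"
  proof
    assume "i \<in> chain_entry n M j"
    moreover from this have "j \<noteq> 0"
      by (intro notI) (simp add: chain_entry_def)
    ultimately show "\<exists>k\<in>?J. k \<le> j"
      using assms(3) by (intro bexI[of _ j]) auto
  qed (use chain_entry_mono[OF assms(1)] in blast)
  finally show ?thesis .
qed

lemma chain_pos_less_iff:
  assumes M: "multichain n M" and i: "i \<in> {1..n}" and j: "j \<in> {1..n}"
  shows "chain_pos n M i < chain_pos n M j \<longleftrightarrow> separates (multichain_exponent M) i j"
proof
  assume less: "chain_pos n M i < chain_pos n M j"
  \<comment> \<open>With this bound the strictly smaller position of \<open>i\<close> is at most
    \<open>length M\<close>. Its entry is then a genuine member of the list, not the conventional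
    last entry, and serves as the separating set.\<close>
  have top: "chain_pos n M j \<le> length M + 1"
    using chain_pos_le_iff[OF M j, of "length M + 1"] j by (simp add: chain_entry_def)
  have "chain_pos n M i \<noteq> 0"
    using chain_pos_le_iff[OF M i, of 0] by (auto simp: chain_entry_def)
  with less top have pos: "0 < chain_pos n M i" "chain_pos n M i \<le> length M"
    by auto
  then have "chain_entry n M (chain_pos n M i) = M ! (chain_pos n M i - 1)"
    by (simp add: chain_entry_def)
  then have "i \<in> M ! (chain_pos n M i - 1)" "j \<notin> M ! (chain_pos n M i - 1)"
    using less top chain_pos_le_iff[OF M i, of "chain_pos n M i"]
      chain_pos_le_iff[OF M j, of "chain_pos n M i"]
    by simp_all
  then show "separates (multichain_exponent M) i j"
    using pos nth_mem[of "chain_pos n M i - 1" M]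
    unfolding separates_def keys_multichain_exponent by auto
next
  assume "separates (multichain_exponent M) i j"
  then obtain k where "k < length M" "i \<in> M ! k" "j \<notin> M ! k"
    by (auto simp: separates_def keys_multichain_exponent in_set_conv_nth)
  \<comment> \<open>List indices start at zero, so \<open>M ! k\<close> is the chain entry with
    number \<open>k + 1\<close>.\<close>
  then have "chain_pos n M i \<le> k + 1" "\<not> chain_pos n M j \<le> k + 1"
    by (subst chain_pos_le_iff[OF M]; use i j in \<open>simp add: chain_entry_def\<close>)+
  then show "chain_pos n M i < chain_pos n M j"
    by linarith
qed

text \<open>The class of the one-letter word acts by \<open>pi_op i\<close>. A multichain has a
  chain-supported exponent, so the three cases of \<open>pi_monomial\<close> become the three
  comparisons of positions.\<close>

lemma hecke_act_pi:
  assumes "i \<in> {1..<n}" "multichain n M"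
  shows "hecke_act n n (hecke_pi n i :: 'k::field free_alg set set) (sr_monomial n M) =
    (if chain_pos n M i > chain_pos n M (i + 1) then \<zero>\<^bsub>stanley_reisner n\<^esub>
     else if chain_pos n M i = chain_pos n M (i + 1) then sr_monomial n M
     else sr_monomial n (chain_swap i M) \<oplus>\<^bsub>stanley_reisner n\<^esub> sr_monomial n M)"
proof -
  let ?e = "multichain_exponent M"
  have "hecke_act n n (hecke_pi n i :: 'k free_alg set set)
      (sr_class n (Poly_Mapping.single ?e 1)) = sr_class n (pi_op i (Poly_Mapping.single ?e 1))"
  proof (rule hecke_act_sr_class)
    show "acts_as n n (pi_op i) x" if "x \<in> hecke_pi n i" for x :: "'k free_alg set"
      using that unfolding hecke_pi_def
      by (rule hecke_class_acts_as[rotated]) (use assms(1) in \<open>simp add: acts_as_hecke_word\<close>)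
    show "hecke_pi n i \<noteq> ({} :: 'k free_alg set set)"
      unfolding hecke_pi_def using hecke_class_self by blast
  qed (use multichain_exponent_closed[OF assms(2)] in simp_all)
  moreover have less: "chain_pos n M i < chain_pos n M (i + 1) \<longleftrightarrow> separates ?e i (i + 1)"
    "chain_pos n M (i + 1) < chain_pos n M i \<longleftrightarrow> separates ?e (i + 1) i"
    using assms by (intro chain_pos_less_iff; simp)+
  moreover have "chain_pos n M i = chain_pos n M (i + 1) \<longleftrightarrow>
      \<not> separates ?e i (i + 1) \<and> \<not> separates ?e (i + 1) i"
    unfolding less[symmetric] by linarith
  moreover have "sr_class n (Poly_Mapping.single (swap_exponent i ?e) 1)
        \<oplus>\<^bsub>stanley_reisner n\<^esub> sr_class n (Poly_Mapping.single ?e 1) =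
      sr_class n (Poly_Mapping.single (swap_exponent i ?e) 1 + Poly_Mapping.single ?e (1 :: 'k))"
    unfolding swap_multichain_exponent
    by (intro stanley_reisner_simps(3) multichain_exponent_closed multichain_swap assms)
  ultimately show ?thesis
    using chain_exponent_multichain[OF assms(2)]
    by (simp add: sr_monomial_def prod_list_sr_var pi_op_monomial pi_monomial_def
        swap_multichain_exponent stanley_reisner_simps(2))
qed

theorem theorem12p1p1:
  shows "\<exists>act :: nat \<Rightarrow> nat \<Rightarrow> 'k::field free_alg set set \<Rightarrow> 'k sr_poly set \<Rightarrow> 'k sr_poly set.
    hecke_module stanley_reisner act \<and>
    (\<forall>n i M. i \<in> {1..<n} \<and> multichain n M \<longrightarrow>
       act n n (hecke_pi n i) (sr_monomial n M) =
         (if chain_pos n M i > chain_pos n M (i + 1) then \<zero>\<^bsub>stanley_reisner n\<^esub>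
          else if chain_pos n M i = chain_pos n M (i + 1) then sr_monomial n M
          else sr_monomial n (chain_swap i M) \<oplus>\<^bsub>stanley_reisner n\<^esub> sr_monomial n M)) \<and>
    (\<forall>n M. multichain n M \<longrightarrow>
       act n (n + 1) (hecke_iota n (n + 1)) (sr_monomial n M) = sr_monomial (n + 1) M)"
proof (intro exI conjI allI impI)
  show "hecke_module (stanley_reisner :: nat \<Rightarrow> ('k, 'k sr_poly set) module) hecke_act"
    by (rule hecke_module_hecke_act)
next
  fix n i M
  assume "i \<in> {1..<n} \<and> multichain n M"
  then show "hecke_act n n (hecke_pi n i :: 'k free_alg set set) (sr_monomial n M) =
      (if chain_pos n M i > chain_pos n M (i + 1) then \<zero>\<^bsub>stanley_reisner n\<^esub>
       else if chain_pos n M i = chain_pos n M (i + 1) then sr_monomial n M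
       else sr_monomial n (chain_swap i M) \<oplus>\<^bsub>stanley_reisner n\<^esub> sr_monomial n M)"
    by (intro hecke_act_pi) auto
next
  fix n M
  assume "multichain n M"
  \<comment> \<open>The principal injection acts by the identity on representatives: the same
    monomial is read modulo the larger ideal.\<close>
  have "hecke_act n (n + 1) (hecke_iota n (n + 1) :: 'k free_alg set set)
      (sr_class n (Poly_Mapping.single (multichain_exponent M) 1)) =
    sr_class (n + 1) (id (Poly_Mapping.single (multichain_exponent M) 1))"
  proof (rule hecke_act_sr_class)
    show "hecke_iota n (n + 1) \<noteq> ({} :: 'k free_alg set set)"
      unfolding hecke_iota_def using hecke_class_self by blast
    show "acts_as n (n + 1) id x" if "x \<in> hecke_iota n (n + 1)" for x :: "'k free_alg set"
      using that by (rule hecke_iota_acts_as)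
  qed (use multichain_exponent_closed[OF \<open>multichain n M\<close>] in simp_all)
  then show "hecke_act n (n + 1) (hecke_iota n (n + 1) :: 'k free_alg set set) (sr_monomial n M) =
      sr_monomial (n + 1) M"
    by (simp add: sr_monomial_def prod_list_sr_var)
qed

end
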